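(* Let $m>0$, $n_{\rm el}>0$, $\eta>0$ with $\eta\neq 1$, and $\zeta\in[0,1]$. Let $\tilde v:\mathbb{R}^2\setminus\{0\}\to\mathbb{R}$ be a measurable function that is positive ($\tilde v(\mathbf q)>0$ for all $\mathbf q$) and $C_4$ symmetric ($\tilde v(C_4\mathbf q)=\tilde v(\mathbf q)$ for all $\mathbf q$), such that the integrals defining the RPA correlation energies per unit area $E_{\rm r}^{\rm pVP}[\zeta]/A$ and $E_{\rm r}^{\rm pSP}[\zeta]/A$ of the partially valley-polarized and partially spin-polarized states exist (are finite). Then $$\frac{E_{\rm r}^{\rm pVP}[\zeta]}{A}<\frac{E_{\rm r}^{\rm pSP}[\zeta]}{A}.$$
   Context: Units with $\hbar=1$; $A$ is the area of the system and $\tilde v$ is the Fourier transform of the electron-electron interaction. $C_4$ is the rotation by $\pi/2$: $C_4(q_x,q_y)=(-q_y,q_x)$. There are four electron flavors $\alpha=1,2,3,4$, standing for (spin, valley) $=(\uparrow,X),(\downarrow,X),(\uparrow,Y),(\downarrow,Y)$, with mass anisotropies $\eta_1=\eta_2=\eta$ and $\eta_3=\eta_4=1/\eta$, and dispersions $$\epsilon_\alpha(\mathbf q)=\frac{q_x^2/\sqrt{\eta_\alpha}+q_y^2\sqrt{\eta_\alpha}}{2m}.$$ Here $n_{\rm el}$ is the total electron density. The flavor densities are $n_\alpha=\nu_\alpha n_{\rm el}$ with $\nu_\alpha\ge 0$, $\sum_\alpha\nu_\alpha=1$. The non-interacting Lindhard function (summed over flavors) at imaginary frequency $i\Omega$,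 $\Omega>0$, is $$\Pi(i\Omega,\mathbf q)=\frac{m}{2\pi}\sum_{\alpha=1}^4\left(1-\operatorname{Re}\sqrt{\Big(1+\frac{i\Omega}{\epsilon_\alpha(\mathbf q)}\Big)^2-\frac{8\pi n_\alpha}{m\,\epsilon_\alpha(\mathbf q)}}\right),$$ with the principal square root (nonnegative real part). The RPA (random phase approximation) correlation energy per unit area of the state with these densities is $$\frac{E_{\rm r}}{A}=\int_0^\infty\frac{d\Omega}{2\pi}\int_{\mathbb{R}^2}\frac{d^2\mathbf q}{(2\pi)^2}\Big\{\log\big[1+\tilde v(\mathbf q)\Pi(i\Omega,\mathbf q)\big]-\tilde v(\mathbf q)\Pi(i\Omega,\mathbf q)\Big\}.$$ $E_{\rm r}^{\rm pVP}[\zeta]$ is this energy for $(\nu_1,\nu_2,\nu_3,\nu_4)=\big(\tfrac{1+\zeta}{4},\tfrac{1+\zeta}{4},\tfrac{1-\zeta}{4},\tfrac{1-\zeta}{4}\big)$ (valley polarization $\nu_1+\nu_2-\nu_3-\nu_4=\zeta$), and $E_{\rm r}^{\rm pSP}[\zeta]$ is this energy for $(\nu_1,\nu_2,\nu_3,\nu_4)=\big(\tfrac{1+\zeta}{4},\tfrac{1-\zeta}{4},\tfrac{1+\zeta}{4},\tfrac{1-\zeta}{4}\big)$ (spin polarization $\nu_1-\nu_2+\nu_3-\nu_4=\zeta$).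
   Formalization: The case ζ=0 is excluded: there both states have all ν equal to 1/4, so the two energies coincide and the strict inequality fails (for example for ṽ(q)=exp(-|q|²)); the claim is proved for every other ζ, that is 0<ζ≤1. *)

theory Defs
  imports "HOL-Analysis.Analysis"
begin

definition C4 :: "real^2 \<Rightarrow> real^2" where
  "C4 q = vector [- (q $ 2), q $ 1]"

text \<open>
  Flavors are indexed by 1, 2, 3, 4, standing for (spin, valley) = (up, X), (down, X),
  (up, Y), (down, Y). Families indexed by flavors are functions on \<^typ>\<open>nat\<close>, of which
  only the values at 1, ..., 4 matter.
\<close>

definition mass_anisotropy :: "real \<Rightarrow> nat \<Rightarrow> real" where
  "mass_anisotropy \<eta> \<alpha> = (if \<alpha> \<in> {1, 2} then \<eta> else 1 / \<eta>)"

definition dispersion :: "real \<Rightarrow> real \<Rightarrow> nat \<Rightarrow> real^2 \<Rightarrow> real" where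
  "dispersion m \<eta> \<alpha> q =
     ((q $ 1)\<^sup>2 / sqrt (mass_anisotropy \<eta> \<alpha>) + (q $ 2)\<^sup>2 * sqrt (mass_anisotropy \<eta> \<alpha>)) / (2 * m)"

text \<open>
  The Lindhard function at imaginary frequency, summed over flavors, for flavor densities
  \<open>\<nu> \<alpha> * n\<^sub>e\<^sub>l\<close>. It is meaningful for nonzero \<open>q\<close> only; at \<open>q = 0\<close> the
  dispersions vanish and the value is an irrelevant artefact of division by zero.
\<close>

definition lindhard ::
  "real \<Rightarrow> real \<Rightarrow> real \<Rightarrow> (nat \<Rightarrow> real) \<Rightarrow> real \<Rightarrow> real^2 \<Rightarrow> real" where
  "lindhard m n_el \<eta> \<nu> \<Omega> q =
     m / (2 * pi) *
     (\<Sum>\<alpha> = 1..4.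
        1 - Re (csqrt ((1 + \<i> * complex_of_real (\<Omega> / dispersion m \<eta> \<alpha> q))\<^sup>2
                 - complex_of_real (8 * pi * (\<nu> \<alpha> * n_el) / (m * dispersion m \<eta> \<alpha> q)))))"

definition rpa_integrand ::
  "real \<Rightarrow> real \<Rightarrow> real \<Rightarrow> (real^2 \<Rightarrow> real) \<Rightarrow> (nat \<Rightarrow> real) \<Rightarrow> real \<Rightarrow> real^2 \<Rightarrow> real" where
  "rpa_integrand m n_el \<eta> v \<nu> \<Omega> q =
     ln (1 + v q * lindhard m n_el \<eta> \<nu> \<Omega> q) - v q * lindhard m n_el \<eta> \<nu> \<Omega> q"

text \<open>The momentum integral. The origin is a null set, so \<open>v 0\<close> plays no role.\<close>

definition rpa_momentum_integral ::
  "real \<Rightarrow> real \<Rightarrow> real \<Rightarrow> (real^2 \<Rightarrow> real) \<Rightarrow> (nat \<Rightarrow> real) \<Rightarrow> real \<Rightarrow> real" where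
  "rpa_momentum_integral m n_el \<eta> v \<nu> \<Omega> =
     (LINT q|lebesgue. rpa_integrand m n_el \<eta> v \<nu> \<Omega> q / (2 * pi)\<^sup>2)"

text \<open>The RPA correlation energy per unit area.\<close>

definition rpa_energy ::
  "real \<Rightarrow> real \<Rightarrow> real \<Rightarrow> (real^2 \<Rightarrow> real) \<Rightarrow> (nat \<Rightarrow> real) \<Rightarrow> real" where
  "rpa_energy m n_el \<eta> v \<nu> =
     (LINT \<Omega>:{0<..}|lebesgue. rpa_momentum_integral m n_el \<eta> v \<nu> \<Omega> / (2 * pi))"

text \<open>
  Existence (finiteness) of the iterated integral defining the energy. It must be required
  separately because the Bochner integral of a non-integrable function is 0. The integrand is
  nonpositive, so by Tonelli this is the same as integrability with respect to \<open>(\<Omega>, q)\<close> jointly.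
\<close>

definition rpa_energy_exists ::
  "real \<Rightarrow> real \<Rightarrow> real \<Rightarrow> (real^2 \<Rightarrow> real) \<Rightarrow> (nat \<Rightarrow> real) \<Rightarrow> bool" where
  "rpa_energy_exists m n_el \<eta> v \<nu> \<longleftrightarrow>
     (AE \<Omega> in lebesgue. 0 < \<Omega> \<longrightarrow>
        integrable lebesgue (\<lambda>q. rpa_integrand m n_el \<eta> v \<nu> \<Omega> q / (2 * pi)\<^sup>2)) \<and>
     set_integrable lebesgue {0<..} (\<lambda>\<Omega>. rpa_momentum_integral m n_el \<eta> v \<nu> \<Omega> / (2 * pi))"

definition pVP :: "real \<Rightarrow> nat \<Rightarrow> real" where
  "pVP \<zeta> \<alpha> = (if \<alpha> \<in> {1, 2} then (1 + \<zeta>) / 4 else (1 - \<zeta>) / 4)"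

definition pSP :: "real \<Rightarrow> nat \<Rightarrow> real" where
  "pSP \<zeta> \<alpha> = (if \<alpha> \<in> {1, 3} then (1 + \<zeta>) / 4 else (1 - \<zeta>) / 4)"

text \<open>Without polarization the two states coincide, so no strict inequality can hold there.\<close>

lemma rpa_energy_unpolarized: "rpa_energy m n_el \<eta> v (pVP 0) = rpa_energy m n_el \<eta> v (pSP 0)"
proof -
  have "pVP 0 = pSP 0" by (auto simp: pVP_def pSP_def)
  then show ?thesis by simp
qed

end

theory Submission
  imports Defs
begin

text \<open>
  Rotation by \<open>C\<^sub>4\<close> exchanges the two valleys, so averaging the Lindhard function of the
  valley-polarized state over \<open>q\<close> and \<open>C\<^sub>4 q\<close> gives that of the spin-polarized state. Since
  \<open>ln (1 + t) - t\<close> is strictly concave and \<open>C\<^sub>4\<close> preserves Lebesgue measure, the momentum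
  integral of the valley-polarized state is at most that of the spin-polarized one. The
  inequality is strict at every frequency: otherwise the difference of the majority and minority
  responses on the axis \<open>q\<^sub>2 = 0\<close>, as a function of \<open>x = 1 / \<epsilon>\<close>, would be invariant under \<open>x \<mapsto> x / \<eta>\<close>,
  which is impossible because its derivative at \<open>x = 0\<close> is nonzero.
\<close>

section \<open>Comparison of integrals and midpoint concavity\<close>

lemma integral_orthogonal_transformation:
  fixes T :: "real^'n::{finite,wellorder} \<Rightarrow> real^'n::_" and f :: "real^'n::_ \<Rightarrow> real"
  assumes T: "orthogonal_transformation T" and f: "integrable lebesgue f"
  shows "integrable lebesgue (\<lambda>x. f (T x))"
    and "(LINT x|lebesgue. f (T x)) = (LINT x|lebesgue. f x)"
proof -
  \<comment> \<open>The linear change of variables is applied to vector-valued functions: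
    \<open>f\<close> is viewed as a map into \<open>real^1\<close> and recovered as its only
    component. The Jacobian factor is 1 because an orthogonal map has determinant 1 or -1.\<close>
  let ?F = "\<lambda>x. (vec (f x) :: real^1)"
  have lin: "linear T" and surj: "T ` UNIV = UNIV" and det: "\<bar>det (matrix T)\<bar> = 1"
    using T orthogonal_transformation_linear orthogonal_transformation_surj by auto
  have bl: "bounded_linear (vec :: real \<Rightarrow> real^1)" "bounded_linear (\<lambda>x::real^1. x $ 1)"
    using linear_linear bounded_linear_vec_nth
    by (auto simp: linear_iff vec_eq_iff intro!: linear_conv_bounded_linear[THEN iffD1])
  have F: "integrable lebesgue ?F"
    using integrable_bounded_linear[OF bl(1) f] .
  then have "?F absolutely_integrable_on T ` UNIV"
    by (simp add: surj set_integrable_def)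
  then have FT: "(?F \<circ> T) absolutely_integrable_on UNIV"
    and eq: "integral UNIV ?F = integral UNIV (?F \<circ> T)"
    using absolutely_integrable_on_linear_image[OF lin, where f = ?F and S = UNIV]
      integral_change_of_variables_linear[OF lin, where f = ?F and S = UNIV] det surj by auto
  then have iFT: "integrable lebesgue (\<lambda>x. ?F (T x))"
    by (simp add: set_integrable_def o_def)
  from integrable_bounded_linear[OF bl(2) this] show i: "integrable lebesgue (\<lambda>x. f (T x))"
    by simp
  have "(LINT x|lebesgue. ?F (T x)) = (LINT x|lebesgue. ?F x)"
    using eq by (simp add: integral_lebesgue[OF F] integral_lebesgue[OF iFT] o_def)
  then show "(LINT x|lebesgue. f (T x)) = (LINT x|lebesgue. f x)"
    using integral_bounded_linear[OF bl(2) F] integral_bounded_linear[OF bl(2) iFT] by simp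
qed

lemma orthogonal_transformation_C4: "orthogonal_transformation C4"
  by (auto simp: orthogonal_transformation_def linear_iff C4_def vec_eq_iff forall_2 inner_vec_def sum_2)

text \<open>A nonnegative difference with zero integral vanishes almost everywhere. This would make
  \<open>U\<close> a null set, but a nonempty open set has positive measure.\<close>

lemma integral_less_open:
  fixes f g :: "'a::euclidean_space \<Rightarrow> real"
  assumes f: "integrable lebesgue f" and g: "integrable lebesgue g"
    and le: "AE x in lebesgue. f x \<le> g x"
    and U: "open U" "U \<noteq> {}" and less: "AE x in lebesgue. x \<in> U \<longrightarrow> f x < g x"
  shows "integral\<^sup>L lebesgue f < integral\<^sup>L lebesgue g"
proof -
  have int: "integrable lebesgue (\<lambda>x. g x - f x)"
    using f g by simp
  have "0 \<le> (LINT x|lebesgue. g x - f x)"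
    by (rule integral_nonneg_AE) (use le in auto)
  moreover have "(LINT x|lebesgue. g x - f x) \<noteq> 0"
  proof
    assume "(LINT x|lebesgue. g x - f x) = 0"
    then have "AE x in lebesgue. g x - f x = 0"
      using integral_nonneg_eq_0_iff_AE[OF int] le by auto
    with less have "AE x in lebesgue. x \<notin> U"
      by eventually_elim auto
    then have "negligible U"
      by (simp add: negligible_iff_null_sets AE_iff_null_sets[symmetric] U(1) borel_open)
    then show False
      using open_not_negligible[OF U] by blast
  qed
  ultimately show ?thesis
    using f g by simp
qed

text \<open>The linear terms cancel, leaving the inequality of arithmetic and geometric means for
  \<open>1 + x\<close> and \<open>1 + y\<close> under the logarithm. The gap
  \<open>((x - y) / 2)\<^sup>2\<close> gives strictness.\<close>

lemma ln_minus_id_midpoint: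
  fixes x y :: real
  assumes "x \<ge> 0" "y \<ge> 0"
  shows "((ln (1 + x) - x) + (ln (1 + y) - y)) / 2 \<le> ln (1 + (x + y) / 2) - (x + y) / 2"
    and "x \<noteq> y \<Longrightarrow> ((ln (1 + x) - x) + (ln (1 + y) - y)) / 2 < ln (1 + (x + y) / 2) - (x + y) / 2"
proof -
  define z where "z = 1 + (x + y) / 2"
  have pos: "1 + x > 0" "1 + y > 0" "z > 0"
    using assms by (auto simp: z_def intro: add_pos_nonneg)
  have ln: "ln (1 + x) + ln (1 + y) = ln ((1 + x) * (1 + y))" "2 * ln z = ln (z\<^sup>2)"
    using pos by (simp_all add: ln_mult ln_realpow)
  have diff: "z\<^sup>2 - (1 + x) * (1 + y) = ((x - y) / 2)\<^sup>2"
    by (simp add: z_def power2_eq_square field_simps)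
  then have "(1 + x) * (1 + y) \<le> z\<^sup>2"
    using zero_le_power2[of "(x - y) / 2"] by linarith
  then have "ln (1 + x) + ln (1 + y) \<le> 2 * ln z"
    unfolding ln using pos by simp
  then show "((ln (1 + x) - x) + (ln (1 + y) - y)) / 2 \<le> ln (1 + (x + y) / 2) - (x + y) / 2"
    unfolding z_def[symmetric] by argo
  assume "x \<noteq> y"
  then have "(x - y) / 2 \<noteq> 0" by simp
  with diff have "(1 + x) * (1 + y) < z\<^sup>2"
    using zero_less_power2[of "(x - y) / 2"] by linarith
  then have "ln (1 + x) + ln (1 + y) < 2 * ln z"
    unfolding ln using pos by simp
  then show "((ln (1 + x) - x) + (ln (1 + y) - y)) / 2 < ln (1 + (x + y) / 2) - (x + y) / 2"
    unfolding z_def[symmetric] by argo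
qed

section \<open>The square root in the Lindhard function, in the variable x = 1/\<epsilon>\<close>

definition lindhard_root :: "real \<Rightarrow> real \<Rightarrow> real \<Rightarrow> real" where
  "lindhard_root \<Omega> \<kappa> x = Re (csqrt ((1 + \<i> * complex_of_real (\<Omega> * x))\<^sup>2 - complex_of_real (\<kappa> * x)))"

text \<open>For \<open>csqrt z\<close> the real part is the square root of (|z| + Re z) / 2. Unlike
  \<open>csqrt\<close> itself, this is continuous across the branch cut, and it reduces continuity
  and differentiation to real calculus.\<close>

lemma lindhard_root_eq:
  "lindhard_root \<Omega> \<kappa> x =
     sqrt ((sqrt ((1 - (\<Omega> * x)\<^sup>2 - \<kappa> * x)\<^sup>2 + (2 * (\<Omega> * x))\<^sup>2) + (1 - (\<Omega> * x)\<^sup>2 - \<kappa> * x)) / 2)"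
  by (simp add: lindhard_root_def cmod_def power2_eq_square)

lemma lindhard_root_le_1:
  assumes "\<kappa> * x \<ge> 0"
  shows "lindhard_root \<Omega> \<kappa> x \<le> 1"
proof -
  define w d where "w = (\<Omega> * x)\<^sup>2" and "d = \<kappa> * x"
  \<comment> \<open>The left side is |z|^2 for the radicand z. The bound |z| \<le> 1 + w + d is what
    is needed: adding Re z = 1 - w - d gives exactly 2.\<close>
  have "(1 - w - d)\<^sup>2 + 4 * w \<le> (1 + w + d)\<^sup>2"
    using assms by (simp add: d_def power2_eq_square algebra_simps)
  then have "sqrt ((1 - w - d)\<^sup>2 + 4 * w) \<le> 1 + w + d"
    by (intro real_le_lsqrt) (use assms in \<open>simp_all add: w_def d_def\<close>)
  then show ?thesis
    by (simp add: lindhard_root_eq power_mult_distrib[of 2] flip: w_def d_def)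
qed

lemma continuous_on_lindhard_root [continuous_intros]:
  "continuous_on S g \<Longrightarrow> continuous_on S (\<lambda>x. lindhard_root \<Omega> \<kappa> (g x))"
  unfolding lindhard_root_eq by (intro continuous_intros) auto

lemma lindhard_root_0 [simp]: "lindhard_root \<Omega> \<kappa> 0 = 1"
  by (simp add: lindhard_root_def)

text \<open>To first order the radicand is 1 + (2i\<Omega> - \<kappa>)x, so the root is 1 +
  (i\<Omega> - \<kappa>/2)x. The frequency drops out of the real part at this order.\<close>

lemma lindhard_root_derivative_0:
  "(lindhard_root \<Omega> \<kappa> has_real_derivative - \<kappa> / 2) (at 0)"
  unfolding lindhard_root_eq
  by (rule derivative_eq_intros refl | simp)+

text \<open>A function invariant under scaling by \<open>c\<close> \<noteq> 1 that is differentiable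
  at 0 must have derivative 0 there, whereas this difference has derivative (\<kappa>' -
  \<kappa>)/2.\<close>

lemma lindhard_root_difference_not_scale_invariant:
  assumes "\<kappa> \<noteq> \<kappa>'" and "c \<noteq> 1"
  obtains x where "x > 0"
    "lindhard_root \<Omega> \<kappa> x - lindhard_root \<Omega> \<kappa>' x \<noteq>
     lindhard_root \<Omega> \<kappa> (c * x) - lindhard_root \<Omega> \<kappa>' (c * x)"
proof (rule ccontr)
  assume "\<not> thesis"
  with that have eq: "lindhard_root \<Omega> \<kappa> x - lindhard_root \<Omega> \<kappa>' x =
     lindhard_root \<Omega> \<kappa> (c * x) - lindhard_root \<Omega> \<kappa>' (c * x)" if "x > 0" for x
    using \<open>x > 0\<close> by blast
  define D where "D x = lindhard_root \<Omega> \<kappa> x - lindhard_root \<Omega> \<kappa>' x -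
     (lindhard_root \<Omega> \<kappa> (c * x) - lindhard_root \<Omega> \<kappa>' (c * x))" for x
  have scaled: "((\<lambda>x. lindhard_root \<Omega> k (c * x)) has_real_derivative (- k / 2) * c) (at 0)" for k
    using lindhard_root_derivative_0[of \<Omega> k]
    by (intro DERIV_chain2[where f = "lindhard_root \<Omega> k"]) (auto intro!: derivative_eq_intros)
  have "(D has_real_derivative (- \<kappa> / 2 - - \<kappa>' / 2) - (- \<kappa> / 2 * c - - \<kappa>' / 2 * c)) (at 0)"
    unfolding D_def by (intro DERIV_diff scaled lindhard_root_derivative_0)
  also have "(- \<kappa> / 2 - - \<kappa>' / 2) - (- \<kappa> / 2 * c - - \<kappa>' / 2 * c) = (\<kappa>' - \<kappa>) / 2 * (1 - c)"
    by (simp add: field_simps)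
  \<comment> \<open>The invariance is available for positive \<open>x\<close> only, so the
    derivative is compared with a limit from the right.\<close>
  finally have "(D has_real_derivative (\<kappa>' - \<kappa>) / 2 * (1 - c)) (at 0 within {0<..})"
    by (rule has_field_derivative_at_within)
  then have "((\<lambda>x. D x / x) \<longlongrightarrow> (\<kappa>' - \<kappa>) / 2 * (1 - c)) (at_right 0)"
    by (simp add: has_field_derivative_iff D_def)
  moreover have "((\<lambda>x. D x / x) \<longlongrightarrow> 0) (at_right 0)"
    by (rule tendsto_eventually) (auto simp: eventually_at_right_field D_def eq intro!: exI[of _ 1])
  ultimately have "(\<kappa>' - \<kappa>) / 2 * (1 - c) = 0"
    using tendsto_unique trivial_limit_at_right_real by blast
  with assms show False by simp
qed

section \<open>Dispersions and Lindhard functions under rotation\<close>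

lemma dispersion_C4:
  assumes "\<eta> > 0"
  shows "dispersion m \<eta> 1 (C4 q) = dispersion m \<eta> 3 q"
    and "dispersion m \<eta> 3 (C4 q) = dispersion m \<eta> 1 q"
  \<comment> \<open>The rotation swaps the squared components of \<open>q\<close>, and replacing
    \<eta> by 1/\<eta> swaps their weights.\<close>
  using assms by (simp_all add: dispersion_def mass_anisotropy_def C4_def real_sqrt_divide)

lemma dispersion_pos:
  assumes "m > 0" "\<eta> > 0" "q \<noteq> 0"
  shows "dispersion m \<eta> \<alpha> q > 0"
proof -
  define s where "s = sqrt (mass_anisotropy \<eta> \<alpha>)"
  have s: "s > 0" using assms by (simp add: s_def mass_anisotropy_def)
  have "q $ 1 \<noteq> 0 \<or> q $ 2 \<noteq> 0"
    using assms by (auto simp: vec_eq_iff forall_2)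
  then have "(q $ 1)\<^sup>2 / s + (q $ 2)\<^sup>2 * s > 0"
    using s by (auto intro: add_pos_nonneg add_nonneg_pos)
  with assms show ?thesis by (simp add: dispersion_def s_def)
qed

lemma C4_nonzero: "q \<noteq> 0 \<Longrightarrow> C4 q \<noteq> 0"
  by (auto simp: C4_def vec_eq_iff forall_2)

definition flavor_response :: "real \<Rightarrow> real \<Rightarrow> real \<Rightarrow> nat \<Rightarrow> real \<Rightarrow> real^2 \<Rightarrow> real" where
  "flavor_response m \<eta> n \<alpha> \<Omega> q = 1 - lindhard_root \<Omega> (8 * pi * n / m) (1 / dispersion m \<eta> \<alpha> q)"

lemma lindhard_eq_flavor_response:
  "lindhard m n_el \<eta> \<nu> \<Omega> q = m / (2 * pi) * (\<Sum>\<alpha> = 1..4. flavor_response m \<eta> (\<nu> \<alpha> * n_el) \<alpha> \<Omega> q)"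
  by (simp add: lindhard_def flavor_response_def lindhard_root_def)

lemma flavor_response_nonneg:
  assumes "m > 0" "\<eta> > 0" "q \<noteq> 0" "n \<ge> 0"
  shows "flavor_response m \<eta> n \<alpha> \<Omega> q \<ge> 0"
  using lindhard_root_le_1[of "8 * pi * n / m" "1 / dispersion m \<eta> \<alpha> q" \<Omega>]
    dispersion_pos[OF assms(1-3), of \<alpha>] assms by (simp add: flavor_response_def)

lemma flavor_response_same_valley:
  "flavor_response m \<eta> n 2 = flavor_response m \<eta> n 1"
  "flavor_response m \<eta> n 4 = flavor_response m \<eta> n 3"
  by (simp_all add: flavor_response_def dispersion_def mass_anisotropy_def fun_eq_iff)

text \<open>Flavors 1 and 3 represent the two valleys. In the valley-polarized state spin partners
  have equal density, which doubles the prefactor; in the spin-polarized state each valley carries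
  both densities.\<close>

lemma lindhard_pVP_pSP:
  fixes n_el \<zeta> :: real
  defines "n \<equiv> (1 + \<zeta>) / 4 * n_el" and "n' \<equiv> (1 - \<zeta>) / 4 * n_el"
  shows "lindhard m n_el \<eta> (pVP \<zeta>) \<Omega> q =
      m / pi * (flavor_response m \<eta> n 1 \<Omega> q + flavor_response m \<eta> n' 3 \<Omega> q)"
    and "lindhard m n_el \<eta> (pSP \<zeta>) \<Omega> q =
      m / (2 * pi) * (flavor_response m \<eta> n 1 \<Omega> q + flavor_response m \<eta> n' 1 \<Omega> q
        + flavor_response m \<eta> n 3 \<Omega> q + flavor_response m \<eta> n' 3 \<Omega> q)"
proof -
  have "{1..4::nat} = {1, 2, 3, 4}" by auto
  then show "lindhard m n_el \<eta> (pVP \<zeta>) \<Omega> q =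
      m / pi * (flavor_response m \<eta> n 1 \<Omega> q + flavor_response m \<eta> n' 3 \<Omega> q)"
    "lindhard m n_el \<eta> (pSP \<zeta>) \<Omega> q =
      m / (2 * pi) * (flavor_response m \<eta> n 1 \<Omega> q + flavor_response m \<eta> n' 1 \<Omega> q
        + flavor_response m \<eta> n 3 \<Omega> q + flavor_response m \<eta> n' 3 \<Omega> q)"
    by (simp_all add: lindhard_eq_flavor_response pVP_def pSP_def flavor_response_same_valley
        n_def n'_def algebra_simps)
qed

lemma lindhard_pVP_nonneg:
  assumes "m > 0" "n_el > 0" "\<eta> > 0" "\<zeta> \<in> {0..1}" "q \<noteq> 0"
  shows "lindhard m n_el \<eta> (pVP \<zeta>) \<Omega> q \<ge> 0"
  unfolding lindhard_pVP_pSP using assms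
  by (intro mult_nonneg_nonneg add_nonneg_nonneg flavor_response_nonneg divide_nonneg_nonneg) auto

lemma flavor_response_C4:
  assumes "\<eta> > 0"
  shows "flavor_response m \<eta> n 1 \<Omega> (C4 q) = flavor_response m \<eta> n 3 \<Omega> q"
    and "flavor_response m \<eta> n 3 \<Omega> (C4 q) = flavor_response m \<eta> n 1 \<Omega> q"
  by (simp_all only: flavor_response_def dispersion_C4[OF assms])

text \<open>The responses at \<open>q\<close> and \<open>C4 q\<close> together contain each pairing
  of a density with a valley exactly once.\<close>

lemma lindhard_pSP_eq_average:
  assumes "\<eta> > 0"
  shows "lindhard m n_el \<eta> (pSP \<zeta>) \<Omega> q =
    (lindhard m n_el \<eta> (pVP \<zeta>) \<Omega> q + lindhard m n_el \<eta> (pVP \<zeta>) \<Omega> (C4 q)) / 2"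
  unfolding lindhard_pVP_pSP flavor_response_C4[OF assms] by (simp add: field_simps)

text \<open>Openness turns a single momentum with unequal responses into a set of positive measure.
  The origin is removed because 1/\<epsilon> is singular there.\<close>

lemma open_lindhard_pVP_anisotropic:
  assumes "m > 0" "\<eta> > 0"
  shows "open {q. q \<noteq> 0 \<and> lindhard m n_el \<eta> (pVP \<zeta>) \<Omega> q \<noteq> lindhard m n_el \<eta> (pVP \<zeta>) \<Omega> (C4 q)}"
proof -
  let ?L = "lindhard m n_el \<eta> (pVP \<zeta>) \<Omega>"
  have disp: "continuous_on (- {0}) (dispersion m \<eta> \<alpha>)" for \<alpha>
    unfolding dispersion_def divide_inverse by (intro continuous_intros)
  have "continuous_on (- {0}) (flavor_response m \<eta> n \<alpha> \<Omega>)" for n \<alpha>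
    unfolding flavor_response_def using dispersion_pos[OF assms]
    by (intro continuous_intros disp) (metis ComplD insertI1 less_irrefl)
  then have "continuous_on (- {0}) (\<lambda>q. ?L q - ?L (C4 q))"
    unfolding lindhard_pVP_pSP flavor_response_C4[OF assms(2)] by (intro continuous_intros)
  then have "open (- {0} \<inter> (\<lambda>q. ?L q - ?L (C4 q)) -` (- {0}))"
    by (intro continuous_open_preimage) auto
  then show ?thesis
    by (rule back_subst[where P = "open"]) auto
qed

lemma lindhard_pVP_anisotropic:
  assumes "m > 0" "n_el > 0" "\<eta> > 0" "\<eta> \<noteq> 1" "\<zeta> \<noteq> 0"
  obtains q where "q \<noteq> 0" "lindhard m n_el \<eta> (pVP \<zeta>) \<Omega> q \<noteq> lindhard m n_el \<eta> (pVP \<zeta>) \<Omega> (C4 q)"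
proof -
  define \<kappa> \<kappa>' where "\<kappa> = 8 * pi * ((1 + \<zeta>) / 4 * n_el) / m" and "\<kappa>' = 8 * pi * ((1 - \<zeta>) / 4 * n_el) / m"
  have "\<kappa> \<noteq> \<kappa>'"
    using assms by (simp add: \<kappa>_def \<kappa>'_def)
  moreover have "1 / \<eta> \<noteq> 1"
    using assms by simp
  ultimately obtain x where x: "x > 0" and neq: "lindhard_root \<Omega> \<kappa> x - lindhard_root \<Omega> \<kappa>' x \<noteq>
     lindhard_root \<Omega> \<kappa> (1 / \<eta> * x) - lindhard_root \<Omega> \<kappa>' (1 / \<eta> * x)"
    using lindhard_root_difference_not_scale_invariant by metis
  \<comment> \<open>The length is chosen so that 1/\<epsilon> equals \<open>x\<close> for flavor 1.
    On this axis the dispersion of flavor 3 is \<eta> times that of flavor 1.\<close>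
  define q :: "real^2" where "q = vector [sqrt (2 * m * sqrt \<eta> / x), 0]"
  have "(q $ 1)\<^sup>2 = 2 * m * sqrt \<eta> / x" "q $ 2 = 0"
    using assms x by (simp_all add: q_def)
  then have "1 / dispersion m \<eta> 1 q = x" "1 / dispersion m \<eta> 3 q = 1 / \<eta> * x"
    using assms x by (simp_all add: dispersion_def mass_anisotropy_def real_sqrt_divide)
  \<comment> \<open>Grouping the terms by valley instead of by density turns the inequality of the
    two Lindhard functions into \<open>neq\<close>.\<close>
  with neq have "lindhard m n_el \<eta> (pVP \<zeta>) \<Omega> q \<noteq> lindhard m n_el \<eta> (pVP \<zeta>) \<Omega> (C4 q)"
    using assms(1) unfolding lindhard_pVP_pSP flavor_response_C4[OF assms(3)]
    unfolding flavor_response_def \<kappa>_def[symmetric] \<kappa>'_def[symmetric] by simp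
  moreover have "q \<noteq> 0"
    using \<open>(q $ 1)\<^sup>2 = _\<close> assms x by auto
  ultimately show ?thesis using that by blast
qed

section \<open>Comparison of momentum integrals and energies\<close>

lemma rpa_momentum_integral_pVP_less_pSP:
  assumes "m > 0" "n_el > 0" "\<eta> > 0" "\<eta> \<noteq> 1" "\<zeta> \<in> {0..1}" "\<zeta> \<noteq> 0"
    and v: "\<And>q. q \<noteq> 0 \<Longrightarrow> v q > 0" "\<And>q. q \<noteq> 0 \<Longrightarrow> v (C4 q) = v q"
    and intVP: "integrable lebesgue (\<lambda>q. rpa_integrand m n_el \<eta> v (pVP \<zeta>) \<Omega> q / (2 * pi)\<^sup>2)"
    and intSP: "integrable lebesgue (\<lambda>q. rpa_integrand m n_el \<eta> v (pSP \<zeta>) \<Omega> q / (2 * pi)\<^sup>2)"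
  shows "rpa_momentum_integral m n_el \<eta> v (pVP \<zeta>) \<Omega> < rpa_momentum_integral m n_el \<eta> v (pSP \<zeta>) \<Omega>"
proof -
  let ?L = "lindhard m n_el \<eta> (pVP \<zeta>) \<Omega>"
  define f g where "f q = rpa_integrand m n_el \<eta> v (pVP \<zeta>) \<Omega> q / (2 * pi)\<^sup>2"
    and "g q = rpa_integrand m n_el \<eta> v (pSP \<zeta>) \<Omega> q / (2 * pi)\<^sup>2" for q
  let ?U = "{q. q \<noteq> 0 \<and> ?L q \<noteq> ?L (C4 q)}"
  have f: "integrable lebesgue f" and g: "integrable lebesgue g"
    using intVP intSP by (simp_all only: f_def[abs_def] g_def[abs_def])
  note fC4 = integral_orthogonal_transformation[OF orthogonal_transformation_C4 f]
  \<comment> \<open>Averaging over the rotation is essential: where \<open>?L q < ?L (C4 q)\<close>,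
    even \<open>f q > g q\<close> holds, since ln (1 + t) - t decreases for t \<ge> 0.\<close>
  have midpoint: "(f q + f (C4 q)) / 2 \<le> g q" "?L q \<noteq> ?L (C4 q) \<Longrightarrow> (f q + f (C4 q)) / 2 < g q"
    if "q \<noteq> 0" for q
  proof -
    have nonneg: "v q * ?L q \<ge> 0" "v q * ?L (C4 q) \<ge> 0"
      using v(1)[OF that] lindhard_pVP_nonneg[OF assms(1,2,3,5)] that C4_nonzero[OF that]
      by (simp_all add: less_imp_le)
    define F where "F t = ln (1 + t) - t" for t :: real
    have fF: "(f q + f (C4 q)) / 2 = (F (v q * ?L q) + F (v q * ?L (C4 q))) / 2 / (2 * pi)\<^sup>2"
      by (simp add: f_def F_def rpa_integrand_def v(2)[OF that] add_divide_distrib)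
    have gF: "g q = F ((v q * ?L q + v q * ?L (C4 q)) / 2) / (2 * pi)\<^sup>2"
      by (simp add: g_def F_def rpa_integrand_def lindhard_pSP_eq_average[OF assms(3)] distrib_left)
    show "(f q + f (C4 q)) / 2 \<le> g q"
      unfolding fF gF using ln_minus_id_midpoint(1)[OF nonneg]
      unfolding F_def by (intro divide_right_mono) simp_all
    show "(f q + f (C4 q)) / 2 < g q" if "?L q \<noteq> ?L (C4 q)"
      unfolding fF gF using ln_minus_id_midpoint(2)[OF nonneg] that v(1)[OF \<open>q \<noteq> 0\<close>]
      unfolding F_def by (intro divide_strict_right_mono) simp_all
  qed
  \<comment> \<open>The origin is discarded: \<open>v\<close> is unconstrained there and the
    dispersions vanish.\<close>
  have "AE q in lebesgue. q \<noteq> (0 :: real^2)"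
    by (intro AE_completion) (auto intro: AE_lborel_singleton)
  then have "AE q in lebesgue. (f q + f (C4 q)) / 2 \<le> g q"
    by eventually_elim (rule midpoint)
  moreover have "?U \<noteq> {}"
    using lindhard_pVP_anisotropic[OF assms(1-4,6)] by blast
  moreover have "AE q in lebesgue. q \<in> ?U \<longrightarrow> (f q + f (C4 q)) / 2 < g q"
    using midpoint by auto
  ultimately have "(LINT q|lebesgue. (f q + f (C4 q)) / 2) < (LINT q|lebesgue. g q)"
    using f g fC4(1) open_lindhard_pVP_anisotropic[OF assms(1,3)]
    by (intro integral_less_open[where U = ?U]) auto
  moreover have "(LINT q|lebesgue. (f q + f (C4 q)) / 2) = (LINT q|lebesgue. f q)"
    using f fC4 by simp
  ultimately show ?thesis
    by (simp add: rpa_momentum_integral_def f_def g_def)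
qed

theorem theorem1:
  fixes m n_el \<eta> \<zeta> :: real and v :: "real^2 \<Rightarrow> real"
  assumes "m > 0" and "n_el > 0" and "\<eta> > 0" and "\<eta> \<noteq> 1"
    and "\<zeta> \<in> {0..1}" and "\<zeta> \<noteq> 0"
    and "v \<in> borel_measurable (lebesgue_on (- {0}))"
    and "\<And>q. q \<noteq> 0 \<Longrightarrow> v q > 0"
    and "\<And>q. q \<noteq> 0 \<Longrightarrow> v (C4 q) = v q"
    and "rpa_energy_exists m n_el \<eta> v (pVP \<zeta>)"
    and "rpa_energy_exists m n_el \<eta> v (pSP \<zeta>)"
  shows "rpa_energy m n_el \<eta> v (pVP \<zeta>) < rpa_energy m n_el \<eta> v (pSP \<zeta>)"
proof -
  let ?I = "\<lambda>\<nu> \<Omega>. rpa_momentum_integral m n_el \<eta> v \<nu> \<Omega> / (2 * pi)"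
  have int: "set_integrable lebesgue {0<..} (?I (pVP \<zeta>))" "set_integrable lebesgue {0<..} (?I (pSP \<zeta>))"
    and "AE \<Omega> in lebesgue. 0 < \<Omega> \<longrightarrow> integrable lebesgue (\<lambda>q. rpa_integrand m n_el \<eta> v (pVP \<zeta>) \<Omega> q / (2 * pi)\<^sup>2)"
    and "AE \<Omega> in lebesgue. 0 < \<Omega> \<longrightarrow> integrable lebesgue (\<lambda>q. rpa_integrand m n_el \<eta> v (pSP \<zeta>) \<Omega> q / (2 * pi)\<^sup>2)"
    using assms(10,11) unfolding rpa_energy_exists_def by blast+
  from this(3,4) have less: "AE \<Omega> in lebesgue. 0 < \<Omega> \<longrightarrow> ?I (pVP \<zeta>) \<Omega> < ?I (pSP \<zeta>) \<Omega>"
  proof eventually_elim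
    case (elim \<Omega>)
    then show ?case
      using rpa_momentum_integral_pVP_less_pSP[OF assms(1-6), of v] assms(8,9) by (simp add: divide_strict_right_mono)
  qed
  \<comment> \<open>Extended by zero, the two integrands agree at nonpositive frequencies;
    strictness comes from the open half-line.\<close>
  have "(LINT \<Omega>|lebesgue. indicator {0<..} \<Omega> *\<^sub>R ?I (pVP \<zeta>) \<Omega>) <
      (LINT \<Omega>|lebesgue. indicator {0<..} \<Omega> *\<^sub>R ?I (pSP \<zeta>) \<Omega>)"
  proof (rule integral_less_open[where U = "{0<..}"])
    show "AE \<Omega> in lebesgue. indicator {0<..} \<Omega> *\<^sub>R ?I (pVP \<zeta>) \<Omega> \<le> indicator {0<..} \<Omega> *\<^sub>R ?I (pSP \<zeta>) \<Omega>"
      using less by eventually_elim (auto simp: indicator_def)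
    show "AE \<Omega> in lebesgue. \<Omega> \<in> {0<..} \<longrightarrow>
        indicator {0<..} \<Omega> *\<^sub>R ?I (pVP \<zeta>) \<Omega> < indicator {0<..} \<Omega> *\<^sub>R ?I (pSP \<zeta>) \<Omega>"
      using less by eventually_elim (auto simp: indicator_def)
  qed (use int in \<open>auto simp: set_integrable_def\<close>)
  then show ?thesis
    by (simp add: rpa_energy_def set_lebesgue_integral_def)
qed

end
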